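(* Let $a,b,c\in\mathbb{R}$ with $abc\neq 0$, and let $\{a_n\}_{n\ge 0}$ be a sequence of real numbers with $(a_0,a_1)\neq(0,0)$ satisfying $c\,a_{n+2}+b\,a_{n+1}+a\,a_n=0$ for all $n\ge 0$. For $m\ge 0$ let $P_m(z)=\sum_{n=0}^{m}a_nz^n$. Let $\alpha$ be a zero of largest modulus of the polynomial $at^2+bt+c$. Suppose $ac<0$ and $a_0b(a_1c+ba_0)\ge 0$. Then for all sufficiently large $m$, with the possible exception of one zero, all the zeros of $P_m(z)$ lie outside the open ball centered at $0$ with radius $|c|/|a\alpha|$. Moreover, the exceptional zero occurs if and only if $|a_1c+ba_0|>|a\alpha a_0|$. *)

theory Defs
  imports "HOL-Computational_Algebra.Computational_Algebra"
begin

definition section_poly :: "(nat \<Rightarrow> real) \<Rightarrow> nat \<Rightarrow> complex poly" where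
  "section_poly u m = (\<Sum>n\<le>m. monom (complex_of_real (u n)) n)"

definition root_of_largest_modulus :: "complex poly \<Rightarrow> complex \<Rightarrow> bool" where
  "root_of_largest_modulus p z \<longleftrightarrow>
     poly p z = 0 \<and> (\<forall>w. poly p w = 0 \<longrightarrow> norm w \<le> norm z)"

(* Counted with multiplicity.  For p = 0 the multiset proots p is empty, so this is
   meaningful only for nonzero p. *)
definition zeros_in_ball :: "complex poly \<Rightarrow> real \<Rightarrow> complex multiset" where
  "zeros_in_ball p r = filter_mset (\<lambda>z. norm z < r) (proots p)"

end

theory Submission
  imports Defs
begin

text \<open>
  As $ac < 0$, the roots $\alpha, \beta$ of $at^2+bt+c$ are real of opposite signs, and the radius
  is $|\beta|$. Put $r = \beta/\alpha \in (-1,0)$, $v_n = \pm a_n \beta^n$ and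
  $e = v_1 - (1+r)v_0$, with the sign chosen so that $e \le 0 \le v_0$. In the variable
  $w = z/\beta$ the sections $S_m(w) = \sum_{n \le m} v_n w^n$ satisfy
  \[ S_m(w)(1-w)(1-rw) = v_0 + e w - v_{m+1} w^{m+1} + r v_m w^{m+2}, \]
  where $v_m$ tends to a limit of the sign of $v_0 + e$ and the coefficients on the right sum to $0$.
  If $v_0 + e > 0$, the constant term dominates on the open unit disc. If $v_0 + e = 0$, the sequence
  is geometric with ratio $r$. If $v_0 + e < 0$, then $S_m(0) \ge 0 > S_m(1)$ gives a real zero $x$;
  after division by $w - x$ the right-hand side has constant contribution $e$ and otherwise
  nonnegative coefficients, and it still vanishes at $w = 1$, hence nowhere on the open disc.
\<close>

section \<open>Section polynomials: rescaling and counting zeros in a ball\<close>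

lemma poly_section_poly: "poly (section_poly v m) w = (\<Sum>n\<le>m. of_real (v n) * w ^ n)"
  by (simp add: section_poly_def poly_sum poly_monom)

lemma section_poly_eq_0_iff: "section_poly v m = 0 \<longleftrightarrow> (\<forall>n\<le>m. v n = 0)"
  by (auto simp: section_poly_def poly_eq_iff coeff_sum coeff_monom sum.delta)

text \<open>The substitution \<open>w = z / y\<close> carries the ball of radius \<open>|y|\<close>
  to the unit disc. The sign \<open>s\<close> enters once inside the new coefficients and once
  outside, so the two copies cancel.\<close>

lemma section_poly_scale:
  assumes "y \<noteq> 0" and "s * s = 1"
  shows "section_poly u m =
    smult (of_real s) (pcompose (section_poly (\<lambda>n. s * u n * y ^ n) m) [:0, of_real (1 / y):])"
proof (rule poly_eq_poly_eq_iff[THEN iffD1], rule ext)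
  fix z :: complex
  have "of_real s * (of_real (s * u n * y ^ n) * (z * of_real (1 / y)) ^ n) = of_real (u n) * z ^ n"
    for n
  proof -
    have "of_real s * (of_real (s * u n * y ^ n) * (z * of_real (1 / y)) ^ n)
        = of_real (s * s) * of_real (u n) * (of_real y ^ n * (z * of_real (1 / y)) ^ n)"
      by simp
    also have "of_real y ^ n * (z * of_real (1 / y)) ^ n = z ^ n"
      using assms(1) by (simp flip: power_mult_distrib)
    finally show ?thesis using assms(2) by simp
  qed
  then show "poly (section_poly u m) z = poly (smult (of_real s)
      (pcompose (section_poly (\<lambda>n. s * u n * y ^ n) m) [:0, of_real (1 / y):])) z"
    unfolding poly_section_poly poly_pcompose poly_smult sum_distrib_left
    by (simp only: poly_pCons poly_0 mult_zero_right add_0_right add_0_left)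
qed

lemma zeros_in_ball_empty_iff:
  assumes "p \<noteq> 0"
  shows "zeros_in_ball p R = {#} \<longleftrightarrow> (\<forall>z. norm z < R \<longrightarrow> poly p z \<noteq> 0)"
  using assms by (auto simp: zeros_in_ball_def)

lemma zeros_in_ball_linear_factor:
  assumes "p \<noteq> 0" and "p = [:- x, 1:] * k" and "norm x < R"
    and "\<And>z. norm z < R \<Longrightarrow> poly k z \<noteq> 0"
  shows "zeros_in_ball p R = {#x#}"
proof -
  have "k \<noteq> 0" using assms(1,2) by auto
  then have "zeros_in_ball k R = {#}" using assms(4) by (simp add: zeros_in_ball_empty_iff)
  moreover have "proots p = {#x#} + proots k"
    unfolding assms(2) using \<open>k \<noteq> 0\<close> by (subst proots_mult) auto
  ultimately show ?thesis using assms(3) by (simp add: zeros_in_ball_def)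
qed

lemma sum_power_less:
  fixes x t :: real
  assumes "0 \<le> x" "0 \<le> t" "t < 1"
  shows "(\<Sum>i<Suc (Suc n). x ^ (Suc n - i) * t ^ i) < (\<Sum>i<Suc (Suc n). x ^ (Suc n - i))"
proof (rule sum_strict_mono_ex1)
  show "\<forall>i\<in>{..<Suc (Suc n)}. x ^ (Suc n - i) * t ^ i \<le> x ^ (Suc n - i)"
    using assms by (auto intro!: mult_left_le power_le_one)
  \<comment> \<open>Strictness must come from the last index: there the power of \<open>x\<close> is
    1 even when \<open>x = 0\<close>, and the exponent of \<open>t\<close> is positive.\<close>
  have "t ^ Suc n < 1" using assms by (simp add: power_less_one_iff del: power_Suc)
  then show "\<exists>i\<in>{..<Suc (Suc n)}. x ^ (Suc n - i) * t ^ i < x ^ (Suc n - i)"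
    by (intro bexI[of _ "Suc n"]) auto
qed simp

section \<open>The normalized recurrence with characteristic roots 1 and \<open>r\<close>\<close>

locale normalized_recurrence =
  fixes v :: "nat \<Rightarrow> real" and r :: real
  assumes rec: "\<And>n. v (n + 2) = (1 + r) * v (n + 1) - r * v n"
    and r: "-1 < r" "r < 0"
    and v0: "0 \<le> v 0"
    and v1: "v 1 \<le> (1 + r) * v 0"
begin

text \<open>The generating function of \<open>v\<close> is
  \<open>(v 0 + e * w) / ((1 - w) * (1 - r * w))\<close>; thus \<open>e\<close> is the linear
  coefficient of its numerator.\<close>

definition e :: real where "e = v 1 - (1 + r) * v 0"

lemma e_le_0: "e \<le> 0"
  using v1 by (simp add: e_def)

text \<open>Partial fractions of the generating function; the factor \<open>1 - r\<close> clears the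
  denominator.\<close>

lemma closed_form: "(1 - r) * v n = (v 0 + e) - (r * v 0 + e) * r ^ n"
proof (induction n rule: induct_nat_012)
  case 0
  show ?case by (simp add: algebra_simps)
next
  case 1
  show ?case by (simp add: e_def algebra_simps)
next
  case (ge2 n)
  have "(1 - r) * v (Suc (Suc n)) = (1 + r) * ((1 - r) * v (Suc n)) - r * ((1 - r) * v n)"
    using arg_cong[OF rec[of n], of "\<lambda>t. (1 - r) * t"] by (simp add: algebra_simps)
  also have "\<dots> = (v 0 + e) - (r * v 0 + e) * r ^ Suc (Suc n)"
    unfolding ge2 by (simp add: algebra_simps)
  finally show ?case .
qed

text \<open>The recurrence cancels all middle coefficients of the product, leaving the numerator of
  the generating function and two terms caused by the truncation.\<close>

lemma section_identity:
  fixes w :: complex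
  shows "poly (section_poly v m) w * ((1 - w) * (1 - of_real r * w)) =
    of_real (v 0) + of_real e * w - of_real (v (m + 1)) * w ^ (m + 1)
      + of_real (r * v m) * w ^ (m + 2)"
proof (induction m)
  case 0
  show ?case by (simp add: poly_section_poly e_def power2_eq_square algebra_simps)
next
  case (Suc m)
  have *: "of_real (v (Suc m + 1)) = (1 + of_real r) * of_real (v (Suc m)) - of_real r * (of_real (v m) :: complex)"
    using arg_cong[OF rec[of m], of "of_real :: real \<Rightarrow> complex"] by simp
  have "poly (section_poly v (Suc m)) w * ((1 - w) * (1 - of_real r * w)) =
     poly (section_poly v m) w * ((1 - w) * (1 - of_real r * w))
     + of_real (v (Suc m)) * w ^ Suc m * ((1 - w) * (1 - of_real r * w))"
    by (simp add: poly_section_poly algebra_simps)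
  also have "\<dots> = of_real (v 0) + of_real e * w - of_real (v (Suc m + 1)) * w ^ (Suc m + 1)
      + of_real (r * v (Suc m)) * w ^ (Suc m + 2)"
    unfolding Suc * by (simp add: algebra_simps)
  finally show ?case .
qed

lemma coefficient_balance: "v 0 + e - v (m + 1) + r * v m = 0"
  \<comment> \<open>At \<open>w = 1\<close> the factor \<open>1 - w\<close> makes the left-hand side
    vanish.\<close>
  using section_identity[of m 1] by (simp flip: of_real_add of_real_diff of_real_mult)

lemma tendsto_v: "(\<lambda>n. (1 - r) * v n) \<longlonglongrightarrow> v 0 + e"
proof -
  have "norm r < 1" using r by auto
  then have "(\<lambda>n. r ^ n) \<longlonglongrightarrow> 0" by (rule LIMSEQ_power_zero)
  then have "(\<lambda>n. (v 0 + e) - (r * v 0 + e) * r ^ n) \<longlonglongrightarrow> (v 0 + e) - (r * v 0 + e) * 0"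
    by (intro tendsto_diff tendsto_mult tendsto_const)
  then show ?thesis by (simp add: closed_form)
qed

lemma no_zeros_if_pos:
  assumes "v 0 + e > 0"
  shows "\<forall>\<^sub>F m in sequentially. \<forall>w. norm w < 1 \<longrightarrow> poly (section_poly v m) w \<noteq> 0"
proof -
  have "\<forall>\<^sub>F n in sequentially. (1 - r) * v n > 0"
    using order_tendstoD(1)[OF tendsto_v assms] .
  then have ev: "\<forall>\<^sub>F n in sequentially. v n > 0"
    by eventually_elim (use r in \<open>simp add: zero_less_mult_iff\<close>)
  then have "\<forall>\<^sub>F n in sequentially. v (n + 1) > 0"
    by (rule eventually_all_ge_at_top[THEN eventually_mono]) auto
  with ev show ?thesis
  proof eventually_elim
    case (elim m)
    show ?case
    proof (intro allI impI notI)
      fix w :: complex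
      assume w: "norm w < 1" and "poly (section_poly v m) w = 0"
      then have "of_real (v 0) = of_real (- e) * w + of_real (v (m + 1)) * w ^ (m + 1)
          + of_real (- r * v m) * w ^ (m + 2)"
        using section_identity[of m w] by (simp add: algebra_simps)
      then have "norm (of_real (v 0) :: complex) \<le> norm (of_real (- e) * w)
          + norm (of_real (v (m + 1)) * w ^ (m + 1)) + norm (of_real (- r * v m) * w ^ (m + 2))"
        by (metis norm_triangle_le norm_triangle_ineq add_right_mono)
      then have "v 0 \<le> - e * norm w + v (m + 1) * norm w ^ (m + 1)
          + (- r * v m) * norm w ^ (m + 2)"
        using elim r v0 e_le_0 by (simp add: norm_mult norm_power abs_mult)
      \<comment> \<open>The strict inequality comes from the term with \<open>v (m + 1) > 0\<close>,
        since \<open>e\<close> may be 0.\<close>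
      also have "\<dots> < - e * 1 + v (m + 1) * 1 + (- r * v m) * 1"
      proof -
        have "norm w ^ (m + 1) < 1" "norm w ^ (m + 2) < 1"
          using w by (simp_all only: power_less_one_iff norm_ge_zero) auto
        then have "v (m + 1) * norm w ^ (m + 1) < v (m + 1) * 1"
          "(- r * v m) * norm w ^ (m + 2) \<le> (- r * v m) * 1"
          using elim r by (auto intro!: mult_left_mono mult_strict_left_mono simp: mult_nonpos_nonneg simp del: mult_1_right)
        moreover have "- e * norm w \<le> - e * 1"
          using w e_le_0 by (intro mult_left_mono) auto
        ultimately show ?thesis by linarith
      qed
      finally show False using coefficient_balance[of m] by simp
    qed
  qed
qed

text \<open>The component along the characteristic root 1 vanishes, so a section is a multiple of a
  finite geometric sum in \<open>r * w\<close>. A zero would make \<open>r * w\<close> a root of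
  unity, although its modulus is less than 1.\<close>

lemma no_zeros_if_zero:
  assumes "v 0 + e = 0" and "v 0 \<noteq> 0" and "norm w < 1"
  shows "poly (section_poly v m) w \<noteq> 0"
proof
  assume *: "poly (section_poly v m) w = 0"
  have v: "v n = v 0 * r ^ n" for n
  proof -
    have e: "e = - v 0" using assms(1) by simp
    have "(1 - r) * v n = (1 - r) * (v 0 * r ^ n)"
      using closed_form[of n] unfolding e by (simp add: algebra_simps)
    then show ?thesis using r by simp
  qed
  have "poly (section_poly v m) w = of_real (v 0) * (\<Sum>n\<le>m. (of_real r * w) ^ n)"
    unfolding poly_section_poly by (subst v) (simp add: sum_distrib_left power_mult_distrib mult_ac)
  with * assms(2) have "(\<Sum>n\<le>m. (of_real r * w) ^ n) = 0" by simp
  then have "(of_real r * w) ^ Suc m = 1"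
    using sum_gp_basic[of "of_real r * w" m] by simp
  then have "norm (of_real r * w) ^ Suc m = 1"
    by (metis norm_one norm_power)
  moreover have "norm (of_real r * w) < 1"
    using r assms(3) mult_strict_mono[of "\<bar>r\<bar>" 1 "norm w" 1] by (simp add: norm_mult)
  then have "norm (of_real r * w) ^ Suc m < 1" by (simp only: power_less_one_iff norm_ge_zero) auto
  ultimately show False by simp
qed

text \<open>Summing the closed form gives a term linear in \<open>m\<close> with slope
  \<open>v 0 + e < 0\<close>, plus a bounded geometric part.\<close>

lemma eventually_sum_neg:
  assumes "v 0 + e < 0"
  shows "\<forall>\<^sub>F m in sequentially. (\<Sum>n\<le>m. v n) < 0"
proof -
  \<comment> \<open>The 2 bounds the geometric sum: \<open>|1 - r ^ Suc m|\<close> is at most 2 and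
    \<open>|1 - r|\<close> is at least 1.\<close>
  have "\<forall>\<^sub>F m in sequentially. 2 * \<bar>r * v 0 + e\<bar> / - (v 0 + e) < real m"
    by (intro eventually_compose_filterlim[OF eventually_gt_at_top filterlim_real_sequentially])
  then show ?thesis
  proof eventually_elim
    case (elim m)
    have "\<bar>r\<bar> ^ Suc m \<le> 1" using r by (intro power_le_one) auto
    then have "\<bar>1 - r ^ Suc m\<bar> \<le> 2" unfolding power_abs[symmetric] by linarith
    moreover have g: "(1 - r) * (\<Sum>n\<le>m. r ^ n) = 1 - r ^ Suc m"
      by (rule sum_gp_basic)
    moreover have "\<bar>\<Sum>n\<le>m. r ^ n\<bar> \<le> \<bar>1 - r\<bar> * \<bar>\<Sum>n\<le>m. r ^ n\<bar>"
      using r mult_right_mono[of 1 "\<bar>1 - r\<bar>" "\<bar>\<Sum>n\<le>m. r ^ n\<bar>"] by simp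
    ultimately have "\<bar>\<Sum>n\<le>m. r ^ n\<bar> \<le> 2" by (metis abs_mult order_trans)
    then have "\<bar>(r * v 0 + e) * (\<Sum>n\<le>m. r ^ n)\<bar> \<le> 2 * \<bar>r * v 0 + e\<bar>"
      unfolding abs_mult using mult_left_mono[of _ 2 "\<bar>r * v 0 + e\<bar>"] by (simp add: mult.commute)
    also have "\<dots> < real m * - (v 0 + e)"
      using elim assms by (simp add: pos_divide_less_eq)
    finally have "\<bar>(r * v 0 + e) * (\<Sum>n\<le>m. r ^ n)\<bar> < real m * - (v 0 + e)" .
    moreover have "(1 - r) * (\<Sum>n\<le>m. v n)
        = real m * (v 0 + e) + (v 0 + e) - (r * v 0 + e) * (\<Sum>n\<le>m. r ^ n)"
      unfolding sum_distrib_left closed_form by (simp add: sum_subtractf algebra_simps)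
    ultimately have "(1 - r) * (\<Sum>n\<le>m. v n) < 0"
      using assms by (simp only: mult_minus_right)
    then show ?case using r by (simp add: mult_less_0_iff)
  qed
qed

lemma one_zero_if_neg:
  assumes "v 0 + e < 0"
  shows "\<forall>\<^sub>F m in sequentially. \<exists>x k. section_poly v m = [:- x, 1:] * k \<and> norm x < 1 \<and>
    (\<forall>w. norm w < 1 \<longrightarrow> poly k w \<noteq> 0)"
proof -
  have "\<forall>\<^sub>F n in sequentially. (1 - r) * v n < 0"
    using order_tendstoD(2)[OF tendsto_v assms] .
  then have ev: "\<forall>\<^sub>F n in sequentially. v n < 0"
    by eventually_elim (use r in \<open>simp add: mult_less_0_iff\<close>)
  then have "\<forall>\<^sub>F n in sequentially. v (n + 1) < 0"
    by (rule eventually_all_ge_at_top[THEN eventually_mono]) auto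
  with ev eventually_sum_neg[OF assms] show ?thesis
  proof eventually_elim
    case (elim m)
    \<comment> \<open>With these names the two truncation terms of \<open>section_identity\<close>
      become \<open>p * w ^ (m + 1) + q * w ^ (m + 2)\<close>, with positive coefficients.\<close>
    define p q where "p = - v (m + 1)" and "q = r * v m"
    have pq: "p > 0" "q > 0" using elim r by (auto simp: p_def q_def mult_neg_neg)
    obtain x where x: "0 \<le> x" "x \<le> 1" and root: "(\<Sum>n\<le>m. v n * x ^ n) = 0"
      using IVT2'[of "\<lambda>x. \<Sum>n\<le>m. v n * x ^ n" 1 0 0] elim v0
      by (force simp: sum.atMost_shift power_0_left intro!: continuous_intros)
    have "x \<noteq> 1" using root elim by auto
    with x have x1: "x < 1" by simp
    have root': "poly (section_poly v m) (of_real x) = 0"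
      using root by (simp add: poly_section_poly flip: of_real_power of_real_mult of_real_sum)
    then obtain k where k: "section_poly v m = [:- of_real x, 1:] * k"
      by (metis poly_eq_0_iff_dvd dvdE)
    \<comment> \<open>Subtracting the identity at \<open>x\<close> from the identity at
      \<open>w\<close> removes \<open>v 0\<close>; \<open>L\<close> is the quotient by
      \<open>w - x\<close>, since each difference of powers divides into a sum with nonnegative
      coefficients.\<close>
    define L :: "complex \<Rightarrow> complex" where "L w = of_real e
        + of_real p * (\<Sum>i<m + 1. of_real x ^ (m - i) * w ^ i)
        + of_real q * (\<Sum>i<m + 2. of_real x ^ (Suc m - i) * w ^ i)" for w
    have L: "poly (section_poly v m) w * ((1 - w) * (1 - of_real r * w)) = (w - of_real x) * L w" for w
    proof -
      have "poly (section_poly v m) w * ((1 - w) * (1 - of_real r * w)) =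
         of_real e * (w - of_real x) + of_real p * (w ^ (m + 1) - of_real x ^ (m + 1))
          + of_real q * (w ^ (m + 2) - of_real x ^ (m + 2))"
        using section_identity[of m w] section_identity[of m "of_real x"]
        unfolding root' by (simp add: p_def q_def algebra_simps)
      also have "\<dots> = (w - of_real x) * L w"
        unfolding L_def power_diff_sumr2 by (simp add: algebra_simps)
      finally show ?thesis .
    qed
    \<comment> \<open>The factor \<open>1 - w\<close> vanishes at 1 while \<open>1 - x\<close> does
      not, so \<open>- e\<close> equals the sum of all the nonnegative coefficients.\<close>
    have "L 1 = 0" using L[of 1] x1 by simp
    then have e: "- e = p * (\<Sum>i<m + 1. x ^ (m - i)) + q * (\<Sum>i<m + 2. x ^ (Suc m - i))"
      unfolding L_def by (simp add: algebra_simps eq_neg_iff_add_eq_0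
          flip: of_real_power of_real_mult of_real_sum of_real_add del: sum.lessThan_Suc)
    have L_nz: "L w \<noteq> 0" if "norm w < 1" for w
    proof
      assume "L w = 0"
      then have "of_real (- e) = of_real p * (\<Sum>i<m + 1. of_real x ^ (m - i) * w ^ i)
        + of_real q * (\<Sum>i<m + 2. of_real x ^ (Suc m - i) * w ^ i)"
        unfolding L_def of_real_minus by (simp only: add.assoc minus_unique)
      then have "norm (of_real (- e) :: complex) \<le> p * norm (\<Sum>i<m + 1. of_real x ^ (m - i) * w ^ i)
        + q * norm (\<Sum>i<m + 2. of_real x ^ (Suc m - i) * w ^ i)"
        using pq by (simp only: norm_triangle_mono norm_mult norm_of_real abs_of_pos order_refl)
      also have "\<dots> \<le> p * (\<Sum>i<m + 1. x ^ (m - i)) + q * (\<Sum>i<m + 2. x ^ (Suc m - i) * norm w ^ i)"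
      proof (intro add_mono mult_left_mono sum_norm_le)
        show "norm (of_real x ^ (m - i) * w ^ i) \<le> x ^ (m - i)" for i
          using x that by (auto simp: norm_mult norm_power intro!: mult_left_le power_le_one)
      qed (use x pq in \<open>auto simp: norm_mult norm_power\<close>)
      \<comment> \<open>Only the second sum gives strictness: for \<open>m = 0\<close> the first one
        is the constant 1.\<close>
      also have "\<dots> < p * (\<Sum>i<m + 1. x ^ (m - i)) + q * (\<Sum>i<m + 2. x ^ (Suc m - i))"
        using sum_power_less[of x "norm w" m] x that pq
        by (simp del: sum.lessThan_Suc)
      finally show False using e by (simp only: norm_of_real)
    qed
    \<comment> \<open>The pointwise identity says nothing about \<open>k\<close> at
      \<open>w = x\<close>. Cancelling the linear factor between polynomials covers this point too,
      so \<open>x\<close> is a simple zero.\<close>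
    define M :: "complex poly" where "M = [:of_real e:]
        + smult (of_real p) (\<Sum>i<m + 1. monom (of_real x ^ (m - i)) i)
        + smult (of_real q) (\<Sum>i<m + 2. monom (of_real x ^ (Suc m - i)) i)"
    have M: "poly M = L"
      by (simp add: M_def L_def poly_sum poly_monom fun_eq_iff del: sum.lessThan_Suc)
    have "[:- of_real x, 1:] * (k * ([:1, -1:] * [:1, - of_real r:])) = [:- of_real x, 1:] * M"
    proof (rule poly_eq_poly_eq_iff[THEN iffD1], rule ext)
      fix w
      show "poly ([:- of_real x, 1:] * (k * ([:1, -1:] * [:1, - of_real r:]))) w
          = poly ([:- of_real x, 1:] * M) w"
        using L[of w] unfolding k poly_mult M by (simp add: mult_ac)
    qed
    then have "k * ([:1, -1:] * [:1, - of_real r:]) = M"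
      by (subst (asm) mult_cancel_left) simp
    then have "poly k w \<noteq> 0" if "norm w < 1" for w
      using L_nz[OF that] M by (metis mult_zero_left poly_mult)
    with k x x1 show ?case by (intro exI[of _ "of_real x"] exI[of _ k]) auto
  qed
qed

end

section \<open>The real roots of the quadratic and the return to the given sequence\<close>

lemma real_roots_of_quadratic:
  fixes a b c :: real and \<alpha> :: complex
  assumes "b \<noteq> 0" and "a * c < 0"
    and "root_of_largest_modulus [:of_real c, of_real b, of_real a:] \<alpha>"
  obtains x y where "\<alpha> = of_real x" "c = a * x * y" "b = - a * (x + y)" "\<bar>y\<bar> < \<bar>x\<bar>" "x * y < 0"
proof -
  have a: "a \<noteq> 0" using assms(2) by auto
  define D where "D = sqrt (b\<^sup>2 - 4 * a * c)"
  have D: "D * D = b\<^sup>2 - 4 * a * c"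
  proof -
    have "0 \<le> b\<^sup>2 - 4 * a * c"
      using assms(2) zero_le_power2[of b] by linarith
    then show ?thesis by (simp add: D_def)
  qed
  define s t where "s = (- b + D) / (2 * a)" and "t = (- b - D) / (2 * a)"
  have st: "c = a * s * t" "b = - a * (s + t)"
  proof -
    have "4 * a * (a * s * t) = b\<^sup>2 - D * D"
      using a by (simp add: s_def t_def field_simps power2_eq_square)
    then show "c = a * s * t" using a D by simp
    show "b = - a * (s + t)" using a by (simp add: s_def t_def field_simps)
  qed
  have fac: "poly [:of_real c, of_real b, of_real a:] z = of_real a * (z - of_real s) * (z - of_real t)" for z :: complex
    unfolding st by (simp add: algebra_simps)
  have neg: "s * t < 0"
  proof -
    have "a * a * (s * t) < 0" using assms(2) st(1) by (simp add: mult_ac)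
    then show ?thesis using a by (simp add: mult_less_0_iff)
  qed
  have le: "norm (of_real s :: complex) \<le> norm \<alpha>" "norm (of_real t :: complex) \<le> norm \<alpha>"
    and "poly [:of_real c, of_real b, of_real a:] \<alpha> = 0"
    using assms(3) fac unfolding root_of_largest_modulus_def by auto
  then have \<alpha>: "\<alpha> = of_real s \<or> \<alpha> = of_real t" using a fac by simp
  \<comment> \<open>Equal moduli would mean \<open>s = t\<close>, against \<open>s * t < 0\<close>,
    or \<open>s = - t\<close>, against \<open>b \<noteq> 0\<close>.\<close>
  have ne: "\<bar>s\<bar> \<noteq> \<bar>t\<bar>" using neg assms(1) st(2) by (auto simp: abs_eq_iff mult_less_0_iff)
  from \<alpha> show ?thesis
  proof
    assume "\<alpha> = of_real s"
    then show ?thesis using that[of s t] st neg ne le by auto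
  next
    assume "\<alpha> = of_real t"
    then show ?thesis using that[of t s] st neg ne le by (auto simp: mult_ac add.commute)
  qed
qed

theorem theorem1:
  fixes a b c :: real and u :: "nat \<Rightarrow> real" and \<alpha> :: complex
  assumes "a * b * c \<noteq> 0"
    and "(u 0, u 1) \<noteq> (0, 0)"
    and "\<And>n. c * u (n + 2) + b * u (n + 1) + a * u n = 0"
    and "root_of_largest_modulus [:of_real c, of_real b, of_real a:] \<alpha>"
    and "a * c < 0"
    and "u 0 * b * (u 1 * c + b * u 0) \<ge> 0"
  shows "\<forall>\<^sub>F m in sequentially.
           section_poly u m \<noteq> 0 \<and>
           size (zeros_in_ball (section_poly u m) (\<bar>c\<bar> / norm (of_real a * \<alpha>))) \<le> 1 \<and>
           (zeros_in_ball (section_poly u m) (\<bar>c\<bar> / norm (of_real a * \<alpha>)) \<noteq> {#} \<longleftrightarrow>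
              \<bar>u 1 * c + b * u 0\<bar> > norm (of_real a * \<alpha> * of_real (u 0)))"
proof -
  have a: "a \<noteq> 0" and b: "b \<noteq> 0" using assms(1) by auto
  obtain x y where \<alpha>: "\<alpha> = of_real x" and cxy: "c = a * x * y" and bxy: "b = - a * (x + y)"
    and yx: "\<bar>y\<bar> < \<bar>x\<bar>" and neg: "x * y < 0"
    using real_roots_of_quadratic[OF b assms(5,4)] .
  have x: "x \<noteq> 0" and y: "y \<noteq> 0" using neg by auto
  have radius: "\<bar>c\<bar> / norm (of_real a * \<alpha>) = \<bar>y\<bar>"
    using a x by (simp add: \<alpha> cxy norm_mult abs_mult)
  define r where "r = y / x"
  have r0: "r < 0" using neg by (auto simp: r_def divide_less_0_iff mult_less_0_iff)
  have "\<bar>r\<bar> < 1" using yx x by (simp add: r_def)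
  then have r1: "-1 < r" by simp
  define d where "d = u 1 * c + b * u 0"
  define e where "e = u 1 * y - (1 + r) * u 0"
  have d: "d = a * x * e"
    using x by (simp add: d_def e_def cxy bxy r_def field_simps)
  \<comment> \<open>As \<open>b = - a * x * (1 + r)\<close> and \<open>d = a * x * e\<close>, the
    sign hypothesis turns into \<open>u 0 * e \<le> 0\<close>.\<close>
  have "u 0 * b * d = - ((a * x)\<^sup>2 * (1 + r)) * (u 0 * e)"
    using x by (simp add: d bxy r_def field_simps power2_eq_square)
  with assms(6) have "(a * x)\<^sup>2 * (1 + r) * (u 0 * e) \<le> 0" by (simp add: d_def)
  moreover have "(a * x)\<^sup>2 * (1 + r) > 0" using a x r1 by simp
  ultimately have ue: "u 0 * e \<le> 0"
    by (smt (verit) mult_pos_pos)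
  then obtain s :: real where s: "s = 1 \<or> s = -1" "0 \<le> s * u 0" "s * e \<le> 0"
    by (force simp: mult_le_0_iff)
  then have ss: "s * s = 1" by auto
  define v where "v = (\<lambda>n. s * u n * y ^ n)"
  have rec: "v (n + 2) = (1 + r) * v (n + 1) - r * v n" for n
  proof -
    \<comment> \<open>The recurrence is written through the roots, then multiplied by
      \<open>y\<close> and divided by \<open>x\<close>, and finally scaled by
      \<open>s * y ^ n\<close>.\<close>
    have "a * (x * y * u (n + 2) - (x + y) * u (n + 1) + u n) = 0"
      using assms(3)[of n] by (simp add: cxy bxy algebra_simps)
    then have "x * y * u (n + 2) = (x + y) * u (n + 1) - u n" using a by simp
    then have "y * (x * y * u (n + 2)) = y * ((x + y) * u (n + 1) - u n)" by simp
    moreover have "x * r = y" using x by (simp add: r_def)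
    ultimately have "x * (y * y * u (n + 2)) = x * ((1 + r) * (y * u (n + 1)) - r * u n)"
      by algebra
    then have "y * y * u (n + 2) = (1 + r) * (y * u (n + 1)) - r * u n" using x by simp
    then have "(s * y ^ n) * (y * y * u (n + 2)) = (s * y ^ n) * ((1 + r) * (y * u (n + 1)) - r * u n)"
      by simp
    then show ?thesis by (simp add: v_def algebra_simps)
  qed
  interpret N: normalized_recurrence v r
    using rec r0 r1 s by unfold_locales (auto simp: v_def e_def algebra_simps)
  have Ne: "N.e = s * e" unfolding N.e_def by (simp add: v_def e_def algebra_simps)
  have crit: "\<bar>u 1 * c + b * u 0\<bar> > norm (of_real a * \<alpha> * of_real (u 0)) \<longleftrightarrow> v 0 + N.e < 0"
  proof -
    have "\<bar>u 1 * c + b * u 0\<bar> > norm (of_real a * \<alpha> * of_real (u 0)) \<longleftrightarrow> \<bar>a * x\<bar> * \<bar>u 0\<bar> < \<bar>a * x\<bar> * \<bar>e\<bar>"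
      using d unfolding d_def by (simp add: \<alpha> norm_mult abs_mult)
    also have "\<dots> \<longleftrightarrow> \<bar>u 0\<bar> < \<bar>e\<bar>" using a x by (subst mult_less_cancel_left_pos) auto
    \<comment> \<open>By the choice of \<open>s\<close>, the absolute values of \<open>u 0\<close>
      and \<open>e\<close> are \<open>v 0\<close> and \<open>- N.e\<close>.\<close>
    also have "\<dots> \<longleftrightarrow> v 0 + N.e < 0" using s unfolding Ne by (auto simp: v_def)
    finally show ?thesis .
  qed
  \<comment> \<open>From \<open>m = 1\<close> on, the section contains both initial values, which
    are not both zero.\<close>
  have nz: "section_poly u m \<noteq> 0" if "m \<ge> 1" for m
    using assms(2) that unfolding section_poly_eq_0_iff by auto
  have scale: "section_poly u m = smult (of_real s) (pcompose (section_poly v m) [:0, of_real (1 / y):])" for m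
    unfolding v_def by (rule section_poly_scale[OF y ss])
  have small: "norm (z * of_real (1 / y)) < 1" if "norm z < \<bar>y\<bar>" for z :: complex
    using that y by (simp add: norm_mult norm_divide)
  have none: "zeros_in_ball (section_poly u m) \<bar>y\<bar> = {#}"
    if "m \<ge> 1" "\<forall>w. norm w < 1 \<longrightarrow> poly (section_poly v m) w \<noteq> 0" for m
    unfolding zeros_in_ball_empty_iff[OF nz[OF that(1)]]
    using that(2) small s(1) by (auto simp: scale[of m] poly_pcompose)
  have one: "\<exists>z. zeros_in_ball (section_poly u m) \<bar>y\<bar> = {#z#}"
    if "m \<ge> 1" and "section_poly v m = [:- w, 1:] * k" "norm w < 1"
      "\<forall>w. norm w < 1 \<longrightarrow> poly k w \<noteq> 0" for m w k
  proof (rule exI, rule zeros_in_ball_linear_factor[OF nz[OF that(1)]])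
    \<comment> \<open>The factor \<open>1 / y\<close> compensates for
      \<open>z - w * y = y * (z / y - w)\<close>.\<close>
    let ?k = "smult (of_real (s / y)) (pcompose k [:0, of_real (1 / y):])"
    show "section_poly u m = [:- (w * of_real y), 1:] * ?k"
      by (rule poly_eq_poly_eq_iff[THEN iffD1], rule ext)
        (use y in \<open>simp add: scale[of m] that(2) poly_pcompose field_simps\<close>)
    show "norm (w * of_real y) < \<bar>y\<bar>" using that(3) y by (simp add: norm_mult)
    show "poly ?k z \<noteq> 0" if "norm z < \<bar>y\<bar>" for z
      using small[OF that] \<open>\<forall>w. norm w < 1 \<longrightarrow> poly k w \<noteq> 0\<close> s(1) y by (auto simp: poly_pcompose)
  qed
  consider "v 0 + N.e > 0" | "v 0 + N.e = 0" | "v 0 + N.e < 0" by linarith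
  then show ?thesis
    unfolding radius crit
  proof cases
    case 1
    show "\<forall>\<^sub>F m in sequentially. section_poly u m \<noteq> 0 \<and> size (zeros_in_ball (section_poly u m) \<bar>y\<bar>) \<le> 1 \<and>
        (zeros_in_ball (section_poly u m) \<bar>y\<bar> \<noteq> {#} \<longleftrightarrow> v 0 + N.e < 0)"
      using N.no_zeros_if_pos[OF 1] eventually_ge_at_top[of 1]
      by eventually_elim (use 1 none nz in auto)
  next
    case 2
    \<comment> \<open>Otherwise \<open>e\<close> vanishes as well, and then
      \<open>u 0 = u 1 = 0\<close>.\<close>
    have "v 0 \<noteq> 0"
    proof
      assume "v 0 = 0"
      with 2 have "v 0 = 0" "s * e = 0" unfolding Ne by auto
      then have "u 0 = 0" "e = 0" using s(1) by (auto simp: v_def)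
      then show False using assms(2) y by (simp add: e_def)
    qed
    show "\<forall>\<^sub>F m in sequentially. section_poly u m \<noteq> 0 \<and> size (zeros_in_ball (section_poly u m) \<bar>y\<bar>) \<le> 1 \<and>
        (zeros_in_ball (section_poly u m) \<bar>y\<bar> \<noteq> {#} \<longleftrightarrow> v 0 + N.e < 0)"
      using eventually_ge_at_top[of 1]
      by eventually_elim (use 2 none nz N.no_zeros_if_zero[OF 2 \<open>v 0 \<noteq> 0\<close>] in auto)
  next
    case 3
    show "\<forall>\<^sub>F m in sequentially. section_poly u m \<noteq> 0 \<and> size (zeros_in_ball (section_poly u m) \<bar>y\<bar>) \<le> 1 \<and>
        (zeros_in_ball (section_poly u m) \<bar>y\<bar> \<noteq> {#} \<longleftrightarrow> v 0 + N.e < 0)"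
      using N.one_zero_if_neg[OF 3] eventually_ge_at_top[of 1]
    proof eventually_elim
      case (elim m)
      then obtain z where "zeros_in_ball (section_poly u m) \<bar>y\<bar> = {#z#}" using one by blast
      then show ?case using 3 nz[OF elim(2)] by simp
    qed
  qed
qed

end
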